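(* Let $n \geq 1$, let $\Omega$ be an open subset of $\mathbb{R}^n$, let $s$ be a real number with $0 \leq s \leq n-1$, and let $f: \Omega \to \mathbb{R}$ be continuous and differentiable $\mathcal{H}^s$-almost everywhere in $\Omega$. Then $$\sup_{\Omega} |\nabla f| = \operatorname*{ess\,sup}_{\Omega} |\nabla f|,$$ where the supremum on the left is over all points of $\Omega$ at which $f$ is differentiable, and the essential supremum is taken with respect to Lebesgue measure. In particular, $$\|\nabla f\|_{L^\infty(\mathcal{H}^s)} = \|\nabla f\|_{L^\infty(\mathcal{H}^n)}.$$
   Context: $\mathcal{H}^s$ denotes the $s$-dimensional Hausdorff measure on $\mathbb{R}^n$; $\mathcal{H}^0$ is counting measure, and $\mathcal{H}^n$ corresponds to Lebesgue measure. "Differentiable $\mathcal{H}^s$-almost everywhere" means that the set of points of $\Omega$ at which $f$ is not (Fréchet) differentiable has $\mathcal{H}^s$-measure zero. $\nabla f$ is the classical pointwise gradient, defined at the points of differentiability of $f$, and $|\cdot|$ is the Euclidean norm. $\|\nabla f\|_{L^\infty(\mathcal{H}^t)}$ is the essential supremum of $|\nabla f|$ over $\Omega$ with respect to $\mathcal{H}^t$, i.e. the infimum of all $M \in [0,\infty]$ such that $\{|\nabla f| > M\}$ has $\mathcal{H}^t$-measure zero. All suprema and essential suprema take values in $[0,\infty]$. *)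

theory Defs
  imports "HOL-Analysis.Analysis" "HOL-Probability.Essential_Supremum"
begin

text \<open>
  The gauge \<open>c(s) diam(U) ^ s\<close>, where \<open>c(s)\<close> is normalised so that in \<open>\<real>\<^sup>n\<close> the measure with
  \<open>s = n\<close> is Lebesgue measure. For \<open>s = 0\<close> the convention \<open>diam(U) ^ 0 = 1\<close> for nonempty \<open>U\<close>
  must be made explicit: points have diameter 0, and \<open>0 powr 0 = 0\<close> in HOL.
\<close>

definition hausdorff_gauge :: "real \<Rightarrow> 'a::metric_space set \<Rightarrow> ennreal" where
  "hausdorff_gauge s U =
     (if U = {} then 0
      else if s = 0 then 1
      else ennreal (unit_ball_vol s / 2 powr s * diameter U powr s))"

text \<open>
  Boundedness is required separately because \<^const>\<open>diameter\<close> is unspecified on unbounded sets.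
  Finite covers are included by padding with empty sets.
\<close>

definition hausdorff_pre :: "real \<Rightarrow> real \<Rightarrow> 'a::metric_space set \<Rightarrow> ennreal" where
  "hausdorff_pre s \<delta> A =
     (INF U \<in> {U :: nat \<Rightarrow> 'a set. A \<subseteq> (\<Union>i. U i) \<and> (\<forall>i. bounded (U i) \<and> diameter (U i) \<le> \<delta>)}.
        \<Sum>i. hausdorff_gauge s (U i))"

text \<open>Hausdorff measure as an outer measure, defined on all sets.\<close>

definition hausdorff_measure :: "real \<Rightarrow> 'a::metric_space set \<Rightarrow> ennreal" where
  "hausdorff_measure s A = (SUP \<delta> \<in> {0<..}. hausdorff_pre s \<delta> A)"

definition diff_points :: "'a::real_normed_vector set \<Rightarrow> ('a \<Rightarrow> 'b::real_normed_vector) \<Rightarrow> 'a set" where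
  "diff_points \<Omega> f = {x \<in> \<Omega>. f differentiable (at x)}"

text \<open>Meaningful only at points of differentiability.\<close>

definition grad :: "('a::real_inner \<Rightarrow> real) \<Rightarrow> 'a \<Rightarrow> 'a" where
  "grad f x = (THE D. GDERIV f x :> D)"

lemma grad_eqI:
  assumes "GDERIV f x :> D"
  shows "grad f x = D"
  unfolding grad_def
proof (rule the_equality)
  show "GDERIV f x :> D" by (fact assms)
next
  fix E assume "GDERIV f x :> E"
  then have "(\<lambda>h. h \<bullet> E) = (\<lambda>h. h \<bullet> D)"
    using assms unfolding gderiv_def by (rule has_derivative_unique)
  then have "h \<bullet> E = h \<bullet> D" for h
    by (rule fun_cong)
  then show "E = D"
    using vector_eq_ldot by blast
qed

text \<open>\<open>\<parallel>\<nabla>f\<parallel>\<close> in \<open>L\<^sup>\<infinity>\<close> of \<open>\<Omega>\<close> with respect to \<open>t\<close>-dimensional Hausdorff measure.\<close>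

definition grad_Linf_hausdorff :: "real \<Rightarrow> 'a::real_inner set \<Rightarrow> ('a \<Rightarrow> real) \<Rightarrow> ennreal" where
  "grad_Linf_hausdorff t \<Omega> f =
     Inf {M. hausdorff_measure t {x \<in> diff_points \<Omega> f. M < ennreal (norm (grad f x))} = 0}"

end

theory Submission
  imports Defs
begin

text \<open>
  Fix a direction \<open>v\<close>. An \<open>H\<^sup>s\<close>-null set with \<open>s \<le> n - 1\<close> has Lebesgue-null shadow along \<open>v\<close>, so
  almost every line parallel to \<open>v\<close> consists of points of differentiability only; by Fubini it also
  meets the set \<open>{|\<nabla>f| > M}\<close> in a null set if that set is Lebesgue-null. On such a line \<open>f\<close> has an
  everywhere existing derivative that is at most \<open>M\<close> almost everywhere, so it increases at rate at
  most \<open>M\<close>; by continuity this carries over to all lines parallel to \<open>v\<close>. Taking \<open>v = \<nabla>f(x)/|\<nabla>f(x)|\<close>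
  yields \<open>|\<nabla>f(x)| \<le> M\<close> at every point \<open>x\<close> of differentiability.
\<close>

section \<open>Efficient covers of Hausdorff-null sets\<close>

text \<open>The measure is a supremum over scales, so its vanishing forces the premeasure at scale 1
  to vanish.\<close>

lemma hausdorff_null_gauge_cover:
  fixes A :: "'a::metric_space set"
  assumes "hausdorff_measure t A = 0" and "0 < e"
  obtains U where "A \<subseteq> (\<Union>i. U i)" "\<And>i. bounded (U i)" "\<And>i. diameter (U i) \<le> 1"
    "(\<Sum>i. hausdorff_gauge t (U i)) < e"
proof -
  have "hausdorff_pre t 1 A \<le> hausdorff_measure t A"
    unfolding hausdorff_measure_def by (rule SUP_upper) auto
  with assms have "hausdorff_pre t 1 A < e" by simp
  then obtain U where "A \<subseteq> (\<Union>i. U i)" "\<forall>i. bounded (U i) \<and> diameter (U i) \<le> 1"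
    "(\<Sum>i. hausdorff_gauge t (U i)) < e"
    unfolding hausdorff_pre_def INF_less_iff by auto
  then show ?thesis by (intro that) auto
qed

text \<open>For exponent 0 each nonempty set costs 1, so a cover of total cost below 1 has only
  empty members. This disposes of exponent 0, which the ball covers below exclude.\<close>

lemma hausdorff_measure_0_eq_0:
  fixes A :: "'a::metric_space set"
  assumes "hausdorff_measure 0 A = 0"
  shows "A = {}"
proof -
  obtain U where U: "A \<subseteq> (\<Union>i. U i)" "(\<Sum>i. hausdorff_gauge 0 (U i)) < 1"
    by (rule hausdorff_null_gauge_cover[OF assms, of 1]) auto
  have "U i = {}" for i
  proof (rule ccontr)
    assume "U i \<noteq> {}"
    then have "1 \<le> (\<Sum>i\<in>{i}. hausdorff_gauge 0 (U i))"
      by (simp add: hausdorff_gauge_def)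
    also have "\<dots> \<le> (\<Sum>i. hausdorff_gauge 0 (U i))"
      by (rule sum_le_suminf) auto
    finally show False using U(2) by simp
  qed
  with U(1) show ?thesis by auto
qed

lemma hausdorff_measure_empty: "hausdorff_measure t ({} :: 'a::metric_space set) = 0"
proof -
  have "hausdorff_pre t \<delta> ({} :: 'a set) \<le> (\<Sum>i::nat. hausdorff_gauge t ({} :: 'a set))" if "0 < \<delta>" for \<delta>
    unfolding hausdorff_pre_def
    by (rule INF_lower2[of "\<lambda>_. {}"]) (use that in \<open>auto simp: diameter_def\<close>)
  then show ?thesis
    by (auto simp: hausdorff_measure_def hausdorff_gauge_def bot_ennreal)
qed

text \<open>A set lies in the ball about any of its points with its diameter as radius. Diameters
  are at most 1, so passing from \<open>t\<close> to the larger integer exponent \<open>p\<close>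
  only lowers the cost.\<close>

lemma hausdorff_null_cball_cover:
  fixes A :: "'a::metric_space set"
  assumes null: "hausdorff_measure t A = 0" and t: "0 < t" "t \<le> real p" and e: "0 < e"
  obtains c r where "A \<subseteq> (\<Union>i. cball (c i) (r i))" "\<And>i. 0 < r i" "\<And>i. r i \<le> 1"
    "(\<Sum>i. ennreal (r i ^ p)) \<le> ennreal e"
proof -
  define K where "K = unit_ball_vol t / 2 powr t"
  have K: "0 < K" using t by (simp add: K_def)
  \<comment> \<open>Half of \<open>e\<close> pays for sets of positive diameter, the other half for
    the rest; the bound 1 keeps all radii at most 1.\<close>
  define h where "h = min 1 (e / 2)"
  have h: "0 < h" "h \<le> 1" "h \<le> e / 2" using e by (auto simp: h_def)
  have "0 < ennreal (K * h)" using K h by simp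
  then obtain U where U: "A \<subseteq> (\<Union>i. U i)" "\<And>i. bounded (U i)" "\<And>i. diameter (U i) \<le> 1"
    "(\<Sum>i. hausdorff_gauge t (U i)) < ennreal (K * h)"
    by (rule hausdorff_null_gauge_cover[OF null]) (rule that)
  define c where "c i = (SOME x. x \<in> U i)" for i
  \<comment> \<open>Singletons and empty sets have diameter 0 but need a positive radius; the
    geometric series makes these radii sum to at most \<open>h\<close>. For empty \<open>U i\<close>
    the centre is arbitrary, which does no harm.\<close>
  define r where "r i = (if 0 < diameter (U i) then diameter (U i) else h * (1 / 2) ^ Suc i)" for i
  have half: "h * (1 / 2) ^ Suc i \<le> 1" for i
    using h by (intro mult_le_one power_le_one) auto
  have r0: "0 < r i" and r1: "r i \<le> 1" for i
    using h U(3)[of i] half[of i] by (auto simp: r_def)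
  have p: "0 < p" using t by (cases p) auto
  have "A \<subseteq> (\<Union>i. cball (c i) (r i))"
  proof
    fix x assume "x \<in> A"
    then obtain i where i: "x \<in> U i" using U(1) by auto
    then have "c i \<in> U i" unfolding c_def by (rule someI)
    then have "dist (c i) x \<le> diameter (U i)"
      using i U(2) by (intro diameter_bounded_bound)
    also have "\<dots> \<le> r i"
      using h(1) by (cases "0 < diameter (U i)") (auto simp: r_def intro: order_trans[of _ 0])
    finally show "x \<in> (\<Union>i. cball (c i) (r i))" by auto
  qed
  moreover have "(\<Sum>i. ennreal (r i ^ p)) \<le> ennreal e"
  proof -
    have le: "ennreal (r i ^ p) \<le> ennreal (1 / K) * hausdorff_gauge t (U i) + ennreal (h * (1 / 2) ^ Suc i)" for i
    proof (cases "0 < diameter (U i)")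
      case True
      then have "U i \<noteq> {}" by auto
      with t have g: "hausdorff_gauge t (U i) = ennreal (K * diameter (U i) powr t)"
        by (simp add: hausdorff_gauge_def K_def)
      have "r i ^ p = diameter (U i) powr real p"
        using True by (simp add: r_def powr_realpow)
      also have "\<dots> \<le> diameter (U i) powr t"
        using True U(3)[of i] t by (intro powr_mono') auto
      finally have "ennreal (r i ^ p) \<le> ennreal (diameter (U i) powr t)"
        by (rule ennreal_leI)
      also have "\<dots> = ennreal (1 / K) * hausdorff_gauge t (U i)"
        using K by (simp add: g ennreal_mult[symmetric])
      finally show ?thesis by (rule order_trans) simp
    next
      case False
      then have "r i ^ p \<le> h * (1 / 2) ^ Suc i"
        using p r0[of i] r1[of i] power_decreasing[of 1 p "r i"] by (simp add: r_def)
      then have "ennreal (r i ^ p) \<le> ennreal (h * (1 / 2) ^ Suc i)"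
        by (rule ennreal_leI)
      then show ?thesis by (rule order_trans) simp
    qed
    have "(\<Sum>i. ennreal (r i ^ p))
        \<le> (\<Sum>i. ennreal (1 / K) * hausdorff_gauge t (U i) + ennreal (h * (1 / 2) ^ Suc i))"
      by (intro suminf_le le) auto
    also have "\<dots> = ennreal (1 / K) * (\<Sum>i. hausdorff_gauge t (U i)) + (\<Sum>i. ennreal (h * (1 / 2) ^ Suc i))"
      by (subst suminf_add[symmetric]) auto
    also have "(\<Sum>i. ennreal (h * (1 / 2) ^ Suc i)) = ennreal h"
      using h sums_mult[OF power_half_series, of h] by (intro suminf_ennreal_eq) auto
    also have "ennreal (1 / K) * (\<Sum>i. hausdorff_gauge t (U i)) \<le> ennreal (1 / K) * ennreal (K * h)"
      using U(4) by (intro mult_left_mono) auto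
    also have "\<dots> = ennreal h" using K h by (simp add: ennreal_mult[symmetric])
    also have "ennreal h + ennreal h = ennreal (h + h)" using h by (intro ennreal_plus[symmetric]) auto
    also have "\<dots> \<le> ennreal e" using h by (intro ennreal_leI) simp
    finally show ?thesis by simp
  qed
  ultimately show ?thesis using r0 r1 by (intro that)
qed

section \<open>Hausdorff-null sets are Lebesgue-null\<close>

lemma negligible_countable_cover:
  fixes S :: "'a::euclidean_space set"
  assumes "\<And>e. 0 < e \<Longrightarrow> \<exists>T :: nat \<Rightarrow> 'a set. S \<subseteq> (\<Union>i. T i) \<and> (\<forall>i. T i \<in> sets lborel)
    \<and> (\<Sum>i. emeasure lborel (T i)) \<le> ennreal e"
  shows "negligible S"
  unfolding negligible_outer_le
proof (intro allI impI)
  fix e :: real assume e: "0 < e"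
  then obtain T :: "nat \<Rightarrow> 'a set" where T: "S \<subseteq> (\<Union>i. T i)" "\<And>i. T i \<in> sets lborel"
    "(\<Sum>i. emeasure lborel (T i)) \<le> ennreal e"
    using assms by blast
  have "emeasure lborel (\<Union>i. T i) \<le> (\<Sum>i. emeasure lborel (T i))"
    using T by (intro emeasure_subadditive_countably) auto
  also note T(3)
  finally have "emeasure lborel (\<Union>i. T i) \<le> ennreal e" .
  moreover have "(\<Union>i. T i) \<in> sets lborel" using T(2) by blast
  ultimately have sets: "(\<Union>i. T i) \<in> sets lebesgue" and le: "emeasure lebesgue (\<Union>i. T i) \<le> ennreal e"
    by simp_all
  have "(\<Union>i. T i) \<in> lmeasurable"
    using sets order_le_less_trans[OF le ennreal_less_top] by (intro fmeasurableI) auto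
  moreover have "measure lebesgue (\<Union>i. T i) \<le> e"
    using le e by (simp add: measure_def enn2real_leI)
  ultimately show "\<exists>V. S \<subseteq> V \<and> V \<in> lmeasurable \<and> measure lebesgue V \<le> e"
    using T(1) by blast
qed

text \<open>Ball covers with \<open>p\<close> equal to the dimension have total volume
  \<open>V\<close> times the sum of the \<open>r i ^ p\<close>, hence arbitrarily small.\<close>

lemma hausdorff_null_imp_negligible:
  fixes A :: "'a::euclidean_space set"
  assumes null: "hausdorff_measure t A = 0" and t: "0 \<le> t" "t \<le> real DIM('a)"
  shows "negligible A"
proof (cases "t = 0")
  case True
  with null have "A = {}" by (simp add: hausdorff_measure_0_eq_0)
  then show ?thesis by simp
next
  case False
  with t have t': "0 < t" by simp
  define V where "V = unit_ball_vol (real DIM('a))"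
  have V: "0 < V" by (simp add: V_def)
  show ?thesis
  proof (rule negligible_countable_cover)
    fix e :: real assume "0 < e"
    then have "0 < e / V" using V by simp
    then obtain c r where cr: "A \<subseteq> (\<Union>i. cball (c i) (r i))" "\<And>i. 0 < r i" "\<And>i. r i \<le> 1"
      "(\<Sum>i. ennreal (r i ^ DIM('a))) \<le> ennreal (e / V)"
      by (rule hausdorff_null_cball_cover[OF null t' t(2)]) (rule that)
    have "(\<Sum>i. emeasure lborel (cball (c i) (r i))) = (\<Sum>i. ennreal V * ennreal (r i ^ DIM('a)))"
      using cr(2) V by (intro suminf_cong) (simp add: emeasure_cball less_imp_le V_def ennreal_mult)
    also have "\<dots> = ennreal V * (\<Sum>i. ennreal (r i ^ DIM('a)))" by simp
    also have "\<dots> \<le> ennreal V * ennreal (e / V)" using cr(4) by (intro mult_left_mono) auto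
    also have "\<dots> = ennreal e" using V \<open>0 < e\<close> by (simp add: ennreal_mult[symmetric])
    finally show "\<exists>T :: nat \<Rightarrow> 'a set. A \<subseteq> (\<Union>i. T i) \<and> (\<forall>i. T i \<in> sets lborel)
      \<and> (\<Sum>i. emeasure lborel (T i)) \<le> ennreal e"
      using cr(1) by (intro exI[of _ "\<lambda>i. cball (c i) (r i)"]) auto
  qed
qed

section \<open>Shadows of Hausdorff-null sets along a direction\<close>

text \<open>Covering the segment by about \<open>2 R / r\<close> balls of radius \<open>2 r\<close> loses one power of \<open>r\<close>.\<close>

lemma cball_segment_shadow:
  fixes c v :: "'a::euclidean_space"
  assumes v: "norm v = 1" and r: "0 < r" "r \<le> 1" and R: "0 \<le> R"
  obtains T where "T \<in> sets lborel" "{y. \<exists>t\<in>{-R..R}. y + t *\<^sub>R v \<in> cball c r} \<subseteq> T"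
    "emeasure lborel T \<le> ennreal ((2 * R + 3) * 2 ^ DIM('a) * unit_ball_vol DIM('a) * r ^ (DIM('a) - 1))"
proof -
  define V where "V = unit_ball_vol (real DIM('a))"
  have V: "0 < V" by (simp add: V_def)
  \<comment> \<open>Grid of mesh \<open>r\<close> on the parameter interval: \<open>t\<close> is
    within \<open>r\<close> of its grid point below, so doubling the radius absorbs the
    error.\<close>
  define J where "J = {\<lfloor>-R/r\<rfloor>..\<lfloor>R/r\<rfloor>}"
  define T where "T = (\<Union>j\<in>J. cball (c - (of_int j * r) *\<^sub>R v) (2 * r))"
  have "of_int (\<lfloor>R/r\<rfloor> - \<lfloor>-R/r\<rfloor> + 1) \<le> 2 * R / r + 2"
    by linarith
  moreover have "\<lfloor>-R/r\<rfloor> \<le> \<lfloor>R/r\<rfloor>"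
    using r R by (intro floor_mono divide_right_mono) auto
  ultimately have cJ: "real (card J) \<le> 2 * R / r + 2"
    by (simp add: J_def)
  have "{y. \<exists>t\<in>{-R..R}. y + t *\<^sub>R v \<in> cball c r} \<subseteq> T"
  proof safe
    fix y t assume t: "t \<in> {-R..R}" and y: "y + t *\<^sub>R v \<in> cball c r"
    define j where "j = \<lfloor>t / r\<rfloor>"
    have "j \<in> J" unfolding J_def j_def
      using t r by (auto intro!: floor_mono divide_right_mono simp: minus_divide_left simp del: minus_divide_left[symmetric])
    have "of_int j \<le> t / r" "t / r < of_int j + 1" unfolding j_def by linarith+
    then have j: "\<bar>t - of_int j * r\<bar> \<le> r" using r by (simp add: field_simps abs_le_iff)
    have "dist (c - (of_int j * r) *\<^sub>R v) y = norm ((c - (y + t *\<^sub>R v)) + (t - of_int j * r) *\<^sub>R v)"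
      by (simp add: dist_norm algebra_simps)
    also have "\<dots> \<le> norm (c - (y + t *\<^sub>R v)) + norm ((t - of_int j * r) *\<^sub>R v)"
      by (rule norm_triangle_ineq)
    also have "\<dots> \<le> r + r"
      using y j v by (intro add_mono) (auto simp: dist_norm)
    finally show "y \<in> T" using \<open>j \<in> J\<close> by (auto simp: T_def)
  qed
  moreover have "T \<in> sets lborel" by (auto simp: T_def J_def)
  moreover have "emeasure lborel T \<le> ennreal ((2 * R + 3) * 2 ^ DIM('a) * V * r ^ (DIM('a) - 1))"
  proof -
    have "emeasure lborel T \<le> (\<Sum>j\<in>J. emeasure lborel (cball (c - (of_int j * r) *\<^sub>R v) (2 * r)))"
      unfolding T_def by (rule emeasure_subadditive_finite) (auto simp: J_def)
    also have "\<dots> = ennreal (real (card J)) * ennreal (V * (2 * r) ^ DIM('a))"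
      using r by (simp add: emeasure_cball V_def ennreal_of_nat_eq_real_of_nat)
    also have "\<dots> = ennreal (real (card J) * (V * (2 * r) ^ DIM('a)))"
      using V r by (simp add: ennreal_mult)
    also have "\<dots> \<le> ennreal ((2 * R + 3) * 2 ^ DIM('a) * V * r ^ (DIM('a) - 1))"
    proof (rule ennreal_leI)
      \<comment> \<open>One factor \<open>r\<close> is split off to cancel the \<open>1 / r\<close>
        in the number of balls; what remains is at most \<open>2 * R + 2 * r\<close>, and
        \<open>r \<le> 1\<close>.\<close>
      have "real (card J) * (V * (2 * r) ^ DIM('a)) = (real (card J) * r) * (2 ^ DIM('a) * V * r ^ (DIM('a) - 1))"
        using power_minus_mult[of "DIM('a)" r] by (simp add: power_mult_distrib mult_ac)
      also have "\<dots> \<le> (2 * R + 3) * (2 ^ DIM('a) * V * r ^ (DIM('a) - 1))"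
      proof (rule mult_right_mono)
        have "real (card J) * r \<le> (2 * R / r + 2) * r" using cJ r by (intro mult_right_mono) auto
        also have "\<dots> = 2 * R + 2 * r" using r by (simp add: field_simps)
        finally show "real (card J) * r \<le> 2 * R + 3" using r by simp
      qed (use V r in auto)
      finally show "real (card J) * (V * (2 * r) ^ DIM('a)) \<le> (2 * R + 3) * 2 ^ DIM('a) * V * r ^ (DIM('a) - 1)"
        by (simp add: mult.assoc)
    qed
    finally show ?thesis .
  qed
  ultimately show ?thesis unfolding V_def by (intro that)
qed

text \<open>The bound \<open>s \<le> n - 1\<close> enters here: a cover with small sum of
  \<open>r i ^ (n - 1)\<close> has a shadow of small volume, since each ball's shadow has volume of
  that order. The case \<open>s = 0\<close> includes dimension 1, where
  \<open>n - 1 = 0\<close>.\<close>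

lemma negligible_hausdorff_null_shadow:
  fixes E :: "'a::euclidean_space set"
  assumes null: "hausdorff_measure s E = 0" and s: "0 \<le> s" "s \<le> real DIM('a) - 1"
    and v: "norm v = 1"
  shows "negligible {y. \<exists>t. y + t *\<^sub>R v \<in> E}"
proof (cases "s = 0")
  case True
  with null have "E = {}" by (simp add: hausdorff_measure_0_eq_0)
  then show ?thesis by simp
next
  case False
  with s have s': "0 < s" "s \<le> real (DIM('a) - 1)" by auto
  \<comment> \<open>The full shadow is a union of whole lines, and a ball has a shadow of finite
    volume only for bounded \<open>t\<close>; hence the exhaustion by natural
    \<open>R\<close>.\<close>
  have "negligible {y. \<exists>t\<in>{-real R..real R}. y + t *\<^sub>R v \<in> E}" for R
  proof (rule negligible_countable_cover)
    define C where "C = (2 * real R + 3) * 2 ^ DIM('a) * unit_ball_vol DIM('a)"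
    have C: "0 < C" by (simp add: C_def add_nonneg_pos)
    fix e :: real assume e: "0 < e"
    then have "0 < e / C" using C by simp
    then obtain c r where cr: "E \<subseteq> (\<Union>i. cball (c i) (r i))"
      "\<And>i. 0 < r i" "\<And>i. r i \<le> 1" "(\<Sum>i. ennreal (r i ^ (DIM('a) - 1))) \<le> ennreal (e / C)"
      by (rule hausdorff_null_cball_cover[OF null s']) (rule that)
    have "\<forall>i. \<exists>T. T \<in> sets lborel \<and> {y. \<exists>t\<in>{-real R..real R}. y + t *\<^sub>R v \<in> cball (c i) (r i)} \<subseteq> T
        \<and> emeasure lborel T \<le> ennreal (C * r i ^ (DIM('a) - 1))"
    proof
      fix i
      show "\<exists>T. T \<in> sets lborel \<and> {y. \<exists>t\<in>{-real R..real R}. y + t *\<^sub>R v \<in> cball (c i) (r i)} \<subseteq> T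
          \<and> emeasure lborel T \<le> ennreal (C * r i ^ (DIM('a) - 1))"
        unfolding C_def
        by (rule cball_segment_shadow[OF v cr(2,3)[of i], of "real R" "c i"]) (simp, intro exI conjI)
    qed
    from choice[OF this]
    obtain T where T: "\<And>i. T i \<in> sets lborel"
      "\<And>i. {y. \<exists>t\<in>{-real R..real R}. y + t *\<^sub>R v \<in> cball (c i) (r i)} \<subseteq> T i"
      "\<And>i. emeasure lborel (T i) \<le> ennreal (C * r i ^ (DIM('a) - 1))"
      by blast
    have "(\<Sum>i. emeasure lborel (T i)) \<le> (\<Sum>i. ennreal (C * r i ^ (DIM('a) - 1)))"
      using T(3) by (intro suminf_le) auto
    also have "\<dots> = (\<Sum>i. ennreal C * ennreal (r i ^ (DIM('a) - 1)))"
      using C cr(2) by (intro suminf_cong ennreal_mult) (auto simp: less_imp_le)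
    also have "\<dots> = ennreal C * (\<Sum>i. ennreal (r i ^ (DIM('a) - 1)))" by simp
    also have "\<dots> \<le> ennreal C * ennreal (e / C)" using cr(4) by (intro mult_left_mono) auto
    also have "\<dots> = ennreal e" using C e by (simp add: ennreal_mult[symmetric])
    finally have "(\<Sum>i. emeasure lborel (T i)) \<le> ennreal e" .
    moreover have "{y. \<exists>t\<in>{-real R..real R}. y + t *\<^sub>R v \<in> E} \<subseteq> (\<Union>i. T i)"
      using cr(1) T(2) by blast
    ultimately show "\<exists>T :: nat \<Rightarrow> 'a set. {y. \<exists>t\<in>{-real R..real R}. y + t *\<^sub>R v \<in> E} \<subseteq> (\<Union>i. T i)
        \<and> (\<forall>i. T i \<in> sets lborel) \<and> (\<Sum>i. emeasure lborel (T i)) \<le> ennreal e"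
      using T(1) by blast
  qed
  then have "negligible (\<Union>R. {y. \<exists>t\<in>{-real R..real R}. y + t *\<^sub>R v \<in> E})"
    by (intro negligible_countable_Union) auto
  moreover have "{y. \<exists>t. y + t *\<^sub>R v \<in> E} \<subseteq> (\<Union>R. {y. \<exists>t\<in>{-real R..real R}. y + t *\<^sub>R v \<in> E})"
  proof safe
    fix y t assume "y + t *\<^sub>R v \<in> E"
    moreover obtain R :: nat where "\<bar>t\<bar> \<le> real R" using real_arch_simple by blast
    ultimately show "y \<in> (\<Union>R. {y. \<exists>t\<in>{-real R..real R}. y + t *\<^sub>R v \<in> E})"
      by (auto simp: abs_le_iff intro!: exI[of _ R] bexI[of _ t])
  qed
  ultimately show ?thesis by (rule negligible_subset)
qed

section \<open>Gradients and increments along lines\<close>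

text \<open>The derivative is a linear functional, and its adjoint applied to 1 is the vector
  representing it; this supplies the existence that the definite description in \<open>grad\<close>
  requires.\<close>

lemma has_derivative_grad:
  fixes f :: "'a::euclidean_space \<Rightarrow> real"
  assumes "f differentiable (at x)"
  shows "(f has_derivative (\<lambda>h. h \<bullet> grad f x)) (at x)"
proof -
  obtain f' where f': "(f has_derivative f') (at x)"
    using assms unfolding differentiable_def by blast
  then have "h \<bullet> adjoint f' 1 = f' h" for h
    using adjoint_works[OF has_derivative_linear, of f f' _ h 1] by simp
  with f' have "GDERIV f x :> adjoint f' 1"
    by (simp add: gderiv_def)
  with grad_eqI show ?thesis by (fastforce simp: gderiv_def)
qed

lemma has_real_derivative_along_line:
  fixes f :: "'a::euclidean_space \<Rightarrow> real"
  assumes "f differentiable (at (y + t *\<^sub>R v))"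
  shows "((\<lambda>t. f (y + t *\<^sub>R v)) has_real_derivative v \<bullet> grad f (y + t *\<^sub>R v)) (at t)"
proof -
  have "((\<lambda>t. y + t *\<^sub>R v) has_derivative (\<lambda>h. h *\<^sub>R v)) (at t)"
    by (auto intro!: derivative_eq_intros)
  from has_derivative_compose[OF this has_derivative_grad[OF assms]]
  show ?thesis
    by (simp add: has_field_derivative_def mult.commute[of "v \<bullet> _"] mult_commute_abs)
qed

text \<open>The Henstock--Kurzweil integral of a derivative that exists everywhere equals the increment
  without any integrability assumption, and it ignores null sets.\<close>

lemma increment_le_of_deriv_le_AE:
  fixes \<phi> \<phi>' :: "real \<Rightarrow> real"
  assumes "a \<le> b" and deriv: "\<And>t. t \<in> {a..b} \<Longrightarrow> (\<phi> has_real_derivative \<phi>' t) (at t)"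
    and neg: "negligible {t \<in> {a..b}. m < \<phi>' t}"
  shows "\<phi> b - \<phi> a \<le> m * (b - a)"
proof -
  have "(\<phi>' has_integral (\<phi> b - \<phi> a)) {a..b}"
    using assms(1) deriv
    by (intro fundamental_theorem_of_calculus)
      (auto simp: has_real_derivative_iff_has_vector_derivative intro: has_vector_derivative_at_within)
  \<comment> \<open>Truncation at \<open>m\<close> alters the integrand only on the negligible set,
    so the integral is unchanged, yet the new integrand is at most \<open>m\<close>
    everywhere.\<close>
  then have "((\<lambda>t. min (\<phi>' t) m) has_integral (\<phi> b - \<phi> a)) {a..b}"
    by (rule has_integral_spike[OF neg, rotated]) auto
  moreover have "((\<lambda>t. m) has_integral ((b - a) *\<^sub>R m)) {a..b}"
    using has_integral_const_real[of m a b] assms(1) by simp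
  ultimately have "\<phi> b - \<phi> a \<le> (b - a) *\<^sub>R m"
    by (rule has_integral_le) auto
  then show ?thesis by (simp add: mult.commute)
qed

text \<open>Fubini for the pairs \<open>(y, t)\<close> with \<open>y + t *\<^sub>R v\<close> in the
  set: for fixed \<open>t\<close> the slice is a translate of a null set, and the order of the two
  quantifiers is then exchanged.\<close>

lemma negligible_on_almost_all_parallel_lines:
  fixes N :: "'a::euclidean_space set"
  assumes "negligible N"
  shows "negligible {y. \<not> negligible {t::real. y + t *\<^sub>R v \<in> N}}"
proof -
  \<comment> \<open>The exchange needs measurability on the product, so \<open>N\<close> is enlarged
    to a Borel null set.\<close>
  obtain N' where N': "N' \<in> null_sets lborel" "N \<subseteq> N'"
    using assms by (auto simp: negligible_iff_null_sets null_sets_completion_iff2)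
  then have [measurable]: "N' \<in> sets borel" by auto
  \<comment> \<open>Needed both on the line and in the space; the exceptional set need not be Borel,
    so the completion is used.\<close>
  have lebesgue_AE: "(AE y in lborel. P y) \<Longrightarrow> negligible {y. \<not> P y}" for P :: "'b::euclidean_space \<Rightarrow> bool"
    using AE_completion[of P lborel]
    by (simp add: AE_iff_null_sets negligible_iff_null_sets eventually_ae_filter null_sets_completion_iff2)
  have "AE y in lborel. y + t *\<^sub>R v \<notin> N'" for t
  proof -
    have "negligible N'" using N'(1) by (simp add: negligible_iff_null_sets null_sets_completionI)
    then have "negligible ((+) (- t *\<^sub>R v) ` N')" by (rule negligible_translation)
    moreover have "{y. y + t *\<^sub>R v \<in> N'} \<subseteq> (+) (- t *\<^sub>R v) ` N'"
    proof
      fix y assume "y \<in> {y. y + t *\<^sub>R v \<in> N'}"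
      then show "y \<in> (+) (- t *\<^sub>R v) ` N'"
        by (intro image_eqI[of _ _ "y + t *\<^sub>R v"]) auto
    qed
    ultimately have "negligible {y. y + t *\<^sub>R v \<in> N'}" by (rule negligible_subset)
    then have "{y. y + t *\<^sub>R v \<in> N'} \<in> null_sets lborel"
      by (simp add: negligible_iff_null_sets null_sets_completion_iff)
    then show ?thesis by (intro AE_I'[of "{y. y + t *\<^sub>R v \<in> N'}"]) auto
  qed
  then have "AE t in lborel. AE y in lborel. y + t *\<^sub>R v \<notin> N'" by simp
  then have "AE y in lborel. AE t in lborel. y + t *\<^sub>R v \<notin> N'"
    by (subst (asm) lborel_pair.AE_commute) measurable
  then have "AE y in lborel. negligible {t::real. y + t *\<^sub>R v \<in> N}"
  proof (rule AE_mp, intro AE_I2 impI)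
    fix y assume "AE t in lborel. y + t *\<^sub>R v \<notin> N'"
    then have "negligible {t::real. \<not> y + t *\<^sub>R v \<notin> N'}" by (rule lebesgue_AE)
    then show "negligible {t::real. y + t *\<^sub>R v \<in> N}"
      by (rule negligible_subset) (use N'(2) in auto)
  qed
  then show ?thesis by (rule lebesgue_AE)
qed

section \<open>From almost everywhere to everywhere\<close>

text \<open>Violating the bound is an open condition on the base point, so one violation gives a
  nonempty open set \<open>W\<close> of them. All lie on exceptional lines, whose base points form a
  negligible set.\<close>

lemma increment_le_of_norm_grad_le_AE:
  fixes f :: "'a::euclidean_space \<Rightarrow> real"
  assumes \<Omega>: "open \<Omega>" "continuous_on \<Omega> f"
    and s: "0 \<le> s" "s \<le> real DIM('a) - 1"
    and null: "hausdorff_measure s {x \<in> \<Omega>. \<not> f differentiable (at x)} = 0"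
    and neg: "negligible {x \<in> diff_points \<Omega> f. m < norm (grad f x)}"
    and v: "norm v = 1" and h: "0 < h" and ball: "ball x \<rho> \<subseteq> \<Omega>" and \<rho>: "h < \<rho>"
  shows "f (x + h *\<^sub>R v) - f x \<le> m * h"
proof (rule ccontr)
  define g where "g y = f (y + h *\<^sub>R v) - f y" for y
  define E where "E = {x \<in> \<Omega>. \<not> f differentiable (at x)}"
  define N where "N = {x \<in> diff_points \<Omega> f. m < norm (grad f x)}"
  \<comment> \<open>Shrinking by \<open>h\<close> keeps each segment of length \<open>h\<close>
    starting in \<open>B\<close> inside \<open>ball x \<rho>\<close>.\<close>
  define B where "B = ball x (\<rho> - h)"
  define W where "W = g -` {m * h<..} \<inter> B"
  assume "\<not> f (x + h *\<^sub>R v) - f x \<le> m * h"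
  then have "x \<in> W" using \<rho> by (simp add: W_def g_def B_def)
  have seg: "y + t *\<^sub>R v \<in> \<Omega>" if "y \<in> B" "0 \<le> t" "t \<le> h" for y t
  proof -
    have "dist x (y + t *\<^sub>R v) \<le> dist x y + dist y (y + t *\<^sub>R v)" by (rule dist_triangle)
    also have "dist y (y + t *\<^sub>R v) \<le> h" using v that by (simp add: dist_norm)
    finally have "y + t *\<^sub>R v \<in> ball x \<rho>" using that(1) by (simp add: B_def)
    with ball show ?thesis by auto
  qed
  have "continuous_on B g"
    unfolding g_def
    using seg[of _ h] seg[of _ 0] h
    by (intro continuous_intros continuous_on_compose2[OF \<Omega>(2)] continuous_on_subset[OF \<Omega>(2)]) auto
  then have "open W"
    unfolding W_def by (subst (asm) continuous_on_open_vimage) (auto simp: B_def)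
  moreover have "W \<subseteq> {y. \<exists>t. y + t *\<^sub>R v \<in> E} \<union> {y. \<not> negligible {t::real. y + t *\<^sub>R v \<in> N}}"
  proof (rule ccontr)
    assume "\<not> W \<subseteq> {y. \<exists>t. y + t *\<^sub>R v \<in> E} \<union> {y. \<not> negligible {t::real. y + t *\<^sub>R v \<in> N}}"
    then obtain y where y: "y \<in> W" "\<And>t. y + t *\<^sub>R v \<notin> E" "negligible {t::real. y + t *\<^sub>R v \<in> N}"
      by blast
    then have yB: "y \<in> B" by (simp add: W_def)
    have diff: "f differentiable (at (y + t *\<^sub>R v))" if "t \<in> {0..h}" for t
      using seg[OF yB, of t] y(2)[of t] that by (auto simp: E_def)
    have "f (y + h *\<^sub>R v) - f (y + 0 *\<^sub>R v) \<le> m * (h - 0)"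
    proof (rule increment_le_of_deriv_le_AE)
      show "((\<lambda>t. f (y + t *\<^sub>R v)) has_real_derivative v \<bullet> grad f (y + t *\<^sub>R v)) (at t)" if "t \<in> {0..h}" for t
        using diff[OF that] by (rule has_real_derivative_along_line)
      have "v \<bullet> u \<le> norm u" for u using norm_cauchy_schwarz[of v u] v by simp
      then have "{t \<in> {0..h}. m < v \<bullet> grad f (y + t *\<^sub>R v)} \<subseteq> {t. y + t *\<^sub>R v \<in> N}"
        using seg[OF yB] diff by (auto simp: N_def diff_points_def intro: less_le_trans)
      with y(3) show "negligible {t \<in> {0..h}. m < v \<bullet> grad f (y + t *\<^sub>R v)}"
        by (rule negligible_subset)
    qed (use h in simp)
    with y(1) show False by (simp add: W_def g_def)
  qed
  then have "negligible W"
    by (rule negligible_subset[rotated])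
      (intro negligible_Un negligible_hausdorff_null_shadow[OF null[folded E_def] s v]
        negligible_on_almost_all_parallel_lines neg[folded N_def])
  ultimately show False using open_not_negligible[of W] \<open>x \<in> W\<close> by blast
qed

lemma norm_grad_le_of_AE:
  fixes f :: "'a::euclidean_space \<Rightarrow> real"
  assumes \<Omega>: "open \<Omega>" "continuous_on \<Omega> f"
    and s: "0 \<le> s" "s \<le> real DIM('a) - 1"
    and null: "hausdorff_measure s {x \<in> \<Omega>. \<not> f differentiable (at x)} = 0"
    and neg: "negligible {x \<in> diff_points \<Omega> f. m < norm (grad f x)}"
    and m: "0 \<le> m" and x: "x \<in> diff_points \<Omega> f"
  shows "norm (grad f x) \<le> m"
\<comment> \<open>A zero gradient gives no unit direction; there \<open>0 \<le> m\<close> settles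
  the claim.\<close>
proof (cases "grad f x = 0")
  case True
  with m show ?thesis by simp
next
  case False
  define v where "v = sgn (grad f x)"
  have v: "norm v = 1" "v \<bullet> grad f x = norm (grad f x)"
    using False by (simp_all add: v_def norm_sgn sgn_div_norm power2_norm_eq_inner[symmetric] power2_eq_square)
  obtain \<rho> where \<rho>: "0 < \<rho>" "ball x \<rho> \<subseteq> \<Omega>"
    using \<Omega>(1) x unfolding open_contains_ball diff_points_def by blast
  have "((\<lambda>t. f (x + t *\<^sub>R v)) has_real_derivative norm (grad f x)) (at 0)"
    using has_real_derivative_along_line[of f x 0 v] x v(2) by (simp add: diff_points_def)
  then have "((\<lambda>h. (f (x + h *\<^sub>R v) - f x) / h) \<longlongrightarrow> norm (grad f x)) (at 0)"
    by (simp add: DERIV_def)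
  \<comment> \<open>The increment bound is for positive \<open>h\<close>, so only the right-hand
    limit is taken.\<close>
  then have lim: "((\<lambda>h. (f (x + h *\<^sub>R v) - f x) / h) \<longlongrightarrow> norm (grad f x)) (at_right 0)"
    by (rule tendsto_within_subset) simp
  have "eventually (\<lambda>h. h \<in> {0<..<\<rho>}) (at_right 0)"
    using \<rho>(1) by (rule eventually_at_right_real)
  then have "eventually (\<lambda>h. (f (x + h *\<^sub>R v) - f x) / h \<le> m) (at_right 0)"
  proof eventually_elim
    case (elim h)
    then have "f (x + h *\<^sub>R v) - f x \<le> m * h"
      by (intro increment_le_of_norm_grad_le_AE[OF \<Omega> s null neg v(1) _ \<rho>(2)]) auto
    with elim show ?case by (simp add: field_simps)
  qed
  with lim show ?thesis by (rule tendsto_upperbound) simp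
qed

section \<open>Measurability of the gradient\<close>

text \<open>Each coordinate is a pointwise limit of difference quotients with steps
  \<open>1 / (k + 1)\<close>. Measurability matters because \<open>esssup\<close> of a
  non-measurable function is the top element by definition.\<close>

lemma borel_measurable_grad:
  fixes f :: "'a::euclidean_space \<Rightarrow> real"
  assumes \<Omega>: "open \<Omega>" "continuous_on \<Omega> f"
  shows "grad f \<in> borel_measurable (lebesgue_on (diff_points \<Omega> f))"
  unfolding borel_measurable_euclidean_space[of "grad f"]
proof
  fix b :: 'a assume "b \<in> Basis"
  \<comment> \<open>Extension by zero makes the quotients Borel on the whole space; as
    \<open>\<Omega>\<close> is open, those at a point of \<open>\<Omega>\<close> eventually involve
    only values of \<open>f\<close>.\<close>
  define g where "g x = indicator \<Omega> x *\<^sub>R f x" for x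
  define q where "q k x = (g (x + inverse (real (Suc k)) *\<^sub>R b) - g x) / inverse (real (Suc k))" for k x
  have g[measurable]: "g \<in> borel_measurable borel"
    unfolding g_def using \<Omega> by (intro borel_measurable_continuous_on_indicator) auto
  have "q k \<in> borel_measurable lborel" for k
    unfolding q_def by measurable
  then have "q k \<in> borel_measurable (lebesgue_on (diff_points \<Omega> f))" for k
    by (intro measurable_restrict_space1 measurable_completion)
  moreover have "(\<lambda>k. q k x) \<longlonglongrightarrow> grad f x \<bullet> b" if "x \<in> space (lebesgue_on (diff_points \<Omega> f))" for x
  proof -
    from that have x: "x \<in> \<Omega>" "f differentiable (at x)" by (auto simp: diff_points_def)
    have "((\<lambda>t. f (x + t *\<^sub>R b)) has_real_derivative grad f x \<bullet> b) (at 0)"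
      using has_real_derivative_along_line[of f x 0 b] x by (simp add: inner_commute)
    then have "((\<lambda>h. (f (x + h *\<^sub>R b) - f x) / h) \<longlongrightarrow> grad f x \<bullet> b) (at 0)"
      by (simp add: DERIV_def)
    moreover have inv: "filterlim (\<lambda>k. inverse (real (Suc k))) (at 0) sequentially"
      unfolding filterlim_at using LIMSEQ_inverse_real_of_nat by simp
    ultimately have "(\<lambda>k. (f (x + inverse (real (Suc k)) *\<^sub>R b) - f x) / inverse (real (Suc k)))
        \<longlonglongrightarrow> grad f x \<bullet> b"
      by (rule filterlim_compose)
    moreover have "eventually (\<lambda>k. (f (x + inverse (real (Suc k)) *\<^sub>R b) - f x) / inverse (real (Suc k)) = q k x)
        sequentially"
    proof -
      have "(\<lambda>k. x + inverse (real (Suc k)) *\<^sub>R b) \<longlonglongrightarrow> x + 0 *\<^sub>R b"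
        by (intro tendsto_intros LIMSEQ_inverse_real_of_nat)
      then have "eventually (\<lambda>k. x + inverse (real (Suc k)) *\<^sub>R b \<in> \<Omega>) sequentially"
        using \<Omega>(1) x(1) by (intro topological_tendstoD) auto
      then show ?thesis
        by eventually_elim (use x(1) in \<open>simp add: q_def g_def\<close>)
    qed
    ultimately show ?thesis by (rule Lim_transform_eventually)
  qed
  ultimately show "(\<lambda>x. grad f x \<bullet> b) \<in> borel_measurable (lebesgue_on (diff_points \<Omega> f))"
    by (rule borel_measurable_LIMSEQ_real[rotated])
qed

section \<open>Comparison of supremum and essential suprema\<close>

lemma sup_norm_grad_le:
  fixes f :: "'a::euclidean_space \<Rightarrow> real"
  assumes \<Omega>: "open \<Omega>" "continuous_on \<Omega> f"
    and s: "0 \<le> s" "s \<le> real DIM('a) - 1"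
    and null: "hausdorff_measure s {x \<in> \<Omega>. \<not> f differentiable (at x)} = 0"
    and neg: "negligible {x \<in> diff_points \<Omega> f. M < ennreal (norm (grad f x))}"
  shows "(SUP x \<in> diff_points \<Omega> f. ennreal (norm (grad f x))) \<le> M"
proof (cases M rule: ennreal_cases)
  case (real m)
  with neg have "negligible {x \<in> diff_points \<Omega> f. m < norm (grad f x)}"
    by (simp add: ennreal_less_iff)
  from norm_grad_le_of_AE[OF \<Omega> s null this real(1)] real show ?thesis
    by (intro SUP_least) (simp add: ennreal_le_iff)
qed simp

text \<open>An \<open>H^t\<close>-null superlevel set is Lebesgue-null, so every essential bound is
  a bound everywhere. The value is therefore the same for all \<open>t\<close> from 0 to the
  dimension, in particular for \<open>s\<close> and \<open>n\<close>.\<close>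

lemma grad_Linf_hausdorff_eq_sup:
  fixes f :: "'a::euclidean_space \<Rightarrow> real"
  assumes \<Omega>: "open \<Omega>" "continuous_on \<Omega> f"
    and s: "0 \<le> s" "s \<le> real DIM('a) - 1"
    and null: "hausdorff_measure s {x \<in> \<Omega>. \<not> f differentiable (at x)} = 0"
    and t: "0 \<le> t" "t \<le> real DIM('a)"
  shows "grad_Linf_hausdorff t \<Omega> f = (SUP x \<in> diff_points \<Omega> f. ennreal (norm (grad f x)))"
  unfolding grad_Linf_hausdorff_def
proof (rule antisym[OF Inf_lower Inf_greatest])
  have "{x \<in> diff_points \<Omega> f. (SUP x \<in> diff_points \<Omega> f. ennreal (norm (grad f x))) < ennreal (norm (grad f x))} = {}"
    by (auto simp: not_less intro: SUP_upper)
  then show "(SUP x \<in> diff_points \<Omega> f. ennreal (norm (grad f x)))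
      \<in> {M. hausdorff_measure t {x \<in> diff_points \<Omega> f. M < ennreal (norm (grad f x))} = 0}"
    by (simp only: hausdorff_measure_empty mem_Collect_eq)
next
  fix M assume "M \<in> {M. hausdorff_measure t {x \<in> diff_points \<Omega> f. M < ennreal (norm (grad f x))} = 0}"
  then show "(SUP x \<in> diff_points \<Omega> f. ennreal (norm (grad f x))) \<le> M"
    using t by (intro sup_norm_grad_le[OF \<Omega> s null] hausdorff_null_imp_negligible[of t]) auto
qed

lemma esssup_norm_grad_eq_sup:
  fixes f :: "'a::euclidean_space \<Rightarrow> real"
  assumes \<Omega>: "open \<Omega>" "continuous_on \<Omega> f"
    and s: "0 \<le> s" "s \<le> real DIM('a) - 1"
    and null: "hausdorff_measure s {x \<in> \<Omega>. \<not> f differentiable (at x)} = 0"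
  shows "esssup (lebesgue_on (diff_points \<Omega> f)) (\<lambda>x. ennreal (norm (grad f x)))
    = (SUP x \<in> diff_points \<Omega> f. ennreal (norm (grad f x)))"
proof (rule antisym)
  define D where "D = diff_points \<Omega> f"
  define S where "S = esssup (lebesgue_on D) (\<lambda>x. ennreal (norm (grad f x)))"
  \<comment> \<open>This makes \<open>D\<close> Lebesgue measurable, so that null sets of
    \<open>lebesgue_on D\<close> are null in the whole space.\<close>
  have "negligible {x \<in> \<Omega>. \<not> f differentiable (at x)}"
    using s by (intro hausdorff_null_imp_negligible[OF null]) auto
  moreover have "D = \<Omega> - {x \<in> \<Omega>. \<not> f differentiable (at x)}"
    by (auto simp: D_def diff_points_def)
  ultimately have D: "D \<in> sets lebesgue"
    using \<Omega>(1) by (auto intro!: sets.Diff dest: negligible_imp_sets)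
  have [measurable]: "grad f \<in> borel_measurable (lebesgue_on D)"
    unfolding D_def by (rule borel_measurable_grad[OF \<Omega>])
  have meas: "(\<lambda>x. ennreal (norm (grad f x))) \<in> borel_measurable (lebesgue_on D)"
    by measurable
  have "{x \<in> space (lebesgue_on D). S < ennreal (norm (grad f x))} \<in> null_sets (lebesgue_on D)"
    unfolding S_def using meas by (intro null_setsI esssup_zero_measure) measurable
  then have "{x \<in> D. S < ennreal (norm (grad f x))} \<in> null_sets lebesgue"
    using D by (simp add: null_sets_restrict_space)
  then show "(SUP x \<in> diff_points \<Omega> f. ennreal (norm (grad f x)))
      \<le> esssup (lebesgue_on (diff_points \<Omega> f)) (\<lambda>x. ennreal (norm (grad f x)))"
    unfolding S_def D_def
    by (intro sup_norm_grad_le[OF \<Omega> s null]) (simp add: negligible_iff_null_sets)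
  show "esssup (lebesgue_on (diff_points \<Omega> f)) (\<lambda>x. ennreal (norm (grad f x)))
      \<le> (SUP x \<in> diff_points \<Omega> f. ennreal (norm (grad f x)))"
    using meas unfolding D_def
    by (intro esssup_I AE_I2) (auto intro: SUP_upper)
qed

theorem theorem1:
  fixes \<Omega> :: "(real ^ 'n) set" and f :: "real ^ 'n \<Rightarrow> real" and s :: real
  assumes "open \<Omega>"
    and "0 \<le> s" and "s \<le> real CARD('n) - 1"
    and "continuous_on \<Omega> f"
    and "hausdorff_measure s {x \<in> \<Omega>. \<not> f differentiable (at x)} = 0"
  shows "(SUP x \<in> diff_points \<Omega> f. ennreal (norm (grad f x)))
           = esssup (lebesgue_on (diff_points \<Omega> f)) (\<lambda>x. ennreal (norm (grad f x)))
         \<and> grad_Linf_hausdorff s \<Omega> f = grad_Linf_hausdorff (real CARD('n)) \<Omega> f"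
proof -
  have s: "s \<le> real DIM(real ^ 'n) - 1" using assms(3) by simp
  note hyps = assms(1,4,2) s assms(5)
  show ?thesis
    using esssup_norm_grad_eq_sup[OF hyps] grad_Linf_hausdorff_eq_sup[OF hyps, of s]
      grad_Linf_hausdorff_eq_sup[OF hyps, of "real CARD('n)"] assms(2,3)
    by simp
qed

end
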